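(* Let $E_{inv}$ be an SL-invariant multipartite measure of entanglement on $\mathcal{H}_n=\mathbb{C}^{d_1}\otimes\cdots\otimes\mathbb{C}^{d_n}$. Let $|\psi\rangle,|\phi\rangle\in\mathcal{H}_n$ be two states with $E_{inv}(|\psi\rangle\langle\psi|)\neq 0$ and $E_{inv}(|\phi\rangle\langle\phi|)\neq 0$. Let $\$$ be an arbitrary quantum channel acting on the first subsystem (so $\$:\mathcal{B}(\mathbb{C}^{d})\to\mathcal{B}(\mathbb{C}^{d})$ with $d=d_1$), and let $\Lambda\equiv\$\otimes\mathbb{I}\otimes\cdots\otimes\mathbb{I}$. Then $$\frac{E_{inv}\left[\Lambda\left(|\psi\rangle\langle\psi|\right)\right]}{E_{inv}(|\psi\rangle\langle\psi|)}=\frac{E_{inv}\left[\Lambda\left(|\phi\rangle\langle\phi|\right)\right]}{E_{inv}(|\phi\rangle\langle\phi|)}=\mathcal{F}[\$],$$ where $\mathcal{F}[\$]$ is the entanglement resilience factor of $\$$.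
   Context: Let $d_1,\dots,d_n$ be positive integers, $\mathcal{H}_n\equiv\mathbb{C}^{d_1}\otimes\cdots\otimes\mathbb{C}^{d_n}$, $\mathcal{B}(\mathcal{H}_n)$ the set of (bounded) linear operators on $\mathcal{H}_n$, and $G\equiv\mathrm{SL}(d_1,\mathbb{C})\otimes\cdots\otimes\mathrm{SL}(d_n,\mathbb{C})$, i.e. the group of operators $g_1\otimes\cdots\otimes g_n$ with each $g_i$ a $d_i\times d_i$ complex matrix of determinant $1$. SL-invariant multipartite measure of entanglement: a not identically zero function $E_{inv}:\mathcal{B}(\mathcal{H}_n)\to[0,\infty)$ such that: (i) $E_{inv}(g\rho g^\dagger)=E_{inv}(\rho)$ for all $g\in G$, $\rho\in\mathcal{B}(\mathcal{H}_n)$; (ii) $E_{inv}(r\rho)=rE_{inv}(\rho)$ for all real $r\ge 0$ and all $\rho\in\mathcal{B}(\mathcal{H}_n)$; (iii) on mixed states (density matrices) it is given by the convex roof: $E_{inv}(\rho)=\min\sum_i p_iE_{inv}(|\psi_i\rangle\langle\psi_i|)$, where the minimum (assumed attained) is over all finite pure-state decompositions $\rho=\sum_i p_i|\psi_i\rangle\langle\psi_i|$ with $p_i\ge 0$ and unit vectors $|\psi_i\rangle\in\mathcal{H}_n$. (By (ii), the value on any positive semidefinite operator is determined by its value on the normalized density matrix.) Quantum channel: a map of the form $\$(\cdot)=\sum_jK_j(\cdot)K_j^\dagger$ (a Kraus representation, finite sum) on $\mathcal{B}(\mathbb{C}^d)$ with $\sum_jK_j^\dagger K_j\le 1$ (so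 trace non-increasing). Entanglement resilience factor: $\mathcal{F}[\$]\equiv\min\sum_j|\det K_j|^{2/d}$, the minimum being over all Kraus representations of $\$$. *)

theory Defs
  imports "Jordan_Normal_Form.Schur_Decomposition" "HOL.Transcendental"
begin

text \<open>
  A family of local dimensions is a list \<open>ds\<close>.  The space
  \<open>H = C^(ds!0) \<otimes> ... \<otimes> C^(ds!(n-1))\<close> is \<open>carrier_vec (prod_list ds)\<close>, where the
  product basis is ordered lexicographically (the first factor is the most significant one),
  and the operators on \<open>H\<close> are \<open>carrier_mat (prod_list ds) (prod_list ds)\<close>.
\<close>

definition kron :: "complex mat \<Rightarrow> complex mat \<Rightarrow> complex mat" where
  "kron A B = mat (dim_row A * dim_row B) (dim_col A * dim_col B)
     (\<lambda>(i, j). A $$ (i div dim_row B, j div dim_col B) * B $$ (i mod dim_row B, j mod dim_col B))"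

definition tensor_list :: "complex mat list \<Rightarrow> complex mat" where
  "tensor_list gs = foldr kron gs (1\<^sub>m 1)"

definition SL_tensor :: "nat list \<Rightarrow> complex mat set" where
  "SL_tensor ds = {tensor_list gs | gs. length gs = length ds \<and>
     (\<forall>i < length ds. gs ! i \<in> carrier_mat (ds ! i) (ds ! i) \<and> det (gs ! i) = 1)}"

definition pure_state :: "nat \<Rightarrow> complex vec \<Rightarrow> bool" where
  "pure_state D v \<longleftrightarrow> v \<in> carrier_vec D \<and> v \<bullet>c v = 1"

definition ketbra :: "complex vec \<Rightarrow> complex mat" where
  "ketbra v = mat (dim_vec v) (dim_vec v) (\<lambda>(i, j). v $ i * cnj (v $ j))"

text \<open>
  In the order on \<open>complex\<close> used here, \<open>0 \<le> z\<close> means that \<open>z\<close> is real and nonnegative; hence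
  the following condition forces \<open>A\<close> to be Hermitian.
\<close>

definition pos_semidef :: "nat \<Rightarrow> complex mat \<Rightarrow> bool" where
  "pos_semidef D A \<longleftrightarrow> A \<in> carrier_mat D D \<and> (\<forall>v \<in> carrier_vec D. 0 \<le> (A *\<^sub>v v) \<bullet>c v)"

definition density_operator :: "nat \<Rightarrow> complex mat \<Rightarrow> bool" where
  "density_operator D \<rho> \<longleftrightarrow> pos_semidef D \<rho> \<and> sum_list (diag_mat \<rho>) = 1"

definition mat_sum :: "nat \<Rightarrow> complex mat list \<Rightarrow> complex mat" where
  "mat_sum D Ms = foldr (+) Ms (0\<^sub>m D D)"

definition pure_decomposition :: "nat \<Rightarrow> complex mat \<Rightarrow> (real \<times> complex vec) list \<Rightarrow> bool" where
  "pure_decomposition D \<rho> ps \<longleftrightarrow>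
     (\<forall>(p, v) \<in> set ps. 0 \<le> p \<and> pure_state D v) \<and>
     \<rho> = mat_sum D (map (\<lambda>(p, v). complex_of_real p \<cdot>\<^sub>m ketbra v) ps)"

definition is_minimum :: "real set \<Rightarrow> real \<Rightarrow> bool" where
  "is_minimum S m \<longleftrightarrow> m \<in> S \<and> (\<forall>x \<in> S. m \<le> x)"

text \<open>
  Only the values of \<open>E\<close> on operators on \<open>H\<close> are meaningful.
\<close>

definition SL_invariant_measure :: "nat list \<Rightarrow> (complex mat \<Rightarrow> real) \<Rightarrow> bool" where
  "SL_invariant_measure ds E \<longleftrightarrow> (let D = prod_list ds in
     (\<forall>\<rho> \<in> carrier_mat D D. 0 \<le> E \<rho>) \<and>
     (\<exists>\<rho> \<in> carrier_mat D D. E \<rho> \<noteq> 0) \<and>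
     (\<forall>g \<in> SL_tensor ds. \<forall>\<rho> \<in> carrier_mat D D. E (g * \<rho> * mat_adjoint g) = E \<rho>) \<and>
     (\<forall>r \<ge> 0. \<forall>\<rho> \<in> carrier_mat D D. E (complex_of_real r \<cdot>\<^sub>m \<rho>) = r * E \<rho>) \<and>
     (\<forall>\<rho>. density_operator D \<rho> \<longrightarrow>
        is_minimum {\<Sum>(p, v) \<leftarrow> ps. p * E (ketbra v) | ps. pure_decomposition D \<rho> ps} (E \<rho>)))"

definition kraus_rep :: "nat \<Rightarrow> (complex mat \<Rightarrow> complex mat) \<Rightarrow> complex mat list \<Rightarrow> bool" where
  "kraus_rep d \<Phi> Ks \<longleftrightarrow> set Ks \<subseteq> carrier_mat d d \<and>
     (\<forall>\<rho> \<in> carrier_mat d d. \<Phi> \<rho> = mat_sum d (map (\<lambda>K. K * \<rho> * mat_adjoint K) Ks))"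

text \<open>
  The operator \<open>\<Sum>\<^sub>j K\<^sub>j\<^sup>\<dagger> K\<^sub>j\<close> depends only on the channel, so the trace condition holds for
  one Kraus representation iff it holds for all of them.
\<close>

definition quantum_channel :: "nat \<Rightarrow> (complex mat \<Rightarrow> complex mat) \<Rightarrow> bool" where
  "quantum_channel d \<Phi> \<longleftrightarrow> (\<exists>Ks. kraus_rep d \<Phi> Ks \<and>
     pos_semidef d (1\<^sub>m d - mat_sum d (map (\<lambda>K. mat_adjoint K * K) Ks)))"

text \<open>
  The map \<open>\<Phi> \<otimes> id\<close> on operators on \<open>C^d \<otimes> C^m\<close>: writing such an operator as
  \<open>\<Sum>\<^sub>a\<^sub>b \<rho>\<^sub>a\<^sub>b \<otimes> |a><b|\<close> with \<open>a, b < m\<close> and \<open>d \<times> d\<close> matrices \<open>\<rho>\<^sub>a\<^sub>b\<close>, it is sent to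
  \<open>\<Sum>\<^sub>a\<^sub>b \<Phi>(\<rho>\<^sub>a\<^sub>b) \<otimes> |a><b|\<close>.
\<close>

definition first_block :: "nat \<Rightarrow> nat \<Rightarrow> complex mat \<Rightarrow> nat \<Rightarrow> nat \<Rightarrow> complex mat" where
  "first_block d m \<rho> a b = mat d d (\<lambda>(k, l). \<rho> $$ (k * m + a, l * m + b))"

definition act_on_first ::
    "nat \<Rightarrow> nat \<Rightarrow> (complex mat \<Rightarrow> complex mat) \<Rightarrow> complex mat \<Rightarrow> complex mat" where
  "act_on_first d m \<Phi> \<rho> = mat (d * m) (d * m)
     (\<lambda>(i, j). \<Phi> (first_block d m \<rho> (i mod m) (j mod m)) $$ (i div m, j div m))"

lemma act_on_first_kron:
  assumes A: "A \<in> carrier_mat d d" and B: "B \<in> carrier_mat m m"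
    and car: "\<Phi> A \<in> carrier_mat d d"
    and hom: "\<And>c. \<Phi> (c \<cdot>\<^sub>m A) = c \<cdot>\<^sub>m \<Phi> A"
  shows "act_on_first d m \<Phi> (kron A B) = kron (\<Phi> A) B"
proof (rule eq_matI)
  fix i j assume "i < dim_row (kron (\<Phi> A) B)" "j < dim_col (kron (\<Phi> A) B)"
  then have ij: "i < d * m" "j < d * m" using car B by (auto simp: kron_def)
  then have m: "0 < m" by (cases m) auto
  have dm: "i div m < d" "j div m < d" using ij by (simp_all add: less_mult_imp_div_less)
  have lt: "k * m + a < d * m" if "k < d" "a < m" for k a
  proof -
    have "k * m + a < Suc k * m" using that by simp
    also have "\<dots> \<le> d * m" using that by (intro mult_le_mono1) simp
    finally show ?thesis .
  qed
  have "first_block d m (kron A B) (i mod m) (j mod m) = B $$ (i mod m, j mod m) \<cdot>\<^sub>m A"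
    by (rule eq_matI) (use A B m in \<open>auto simp: first_block_def kron_def lt\<close>)
  then show "act_on_first d m \<Phi> (kron A B) $$ (i, j) = kron (\<Phi> A) B $$ (i, j)"
    using ij dm car B by (auto simp: act_on_first_def kron_def hom)
qed (use car B in \<open>auto simp: act_on_first_def kron_def\<close>)

definition resilience_values :: "nat \<Rightarrow> (complex mat \<Rightarrow> complex mat) \<Rightarrow> real set" where
  "resilience_values d \<Phi> = {\<Sum>K \<leftarrow> Ks. cmod (det K) powr (2 / real d) | Ks. kraus_rep d \<Phi> Ks}"

definition resilience_factor :: "nat \<Rightarrow> (complex mat \<Rightarrow> complex mat) \<Rightarrow> real" where
  "resilience_factor d \<Phi> = (THE m. is_minimum (resilience_values d \<Phi>) m)"

end

(*
  Identify a vector of C^d (x) C^m with a d x m matrix Psi, so that A (x) 1 acts by Psi |-> A Psi,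
  and write E(Psi) for the measure of the corresponding pure state.

  If det A is nonzero, A is a scalar c with c^d = det A times an element of SL(d), hence
  E(A Psi) = |det A|^(2/d) E(Psi).  If w A = 0 for a nonzero row vector w, some g in SL(d) satisfies
  g A = 2 A, hence E(A Psi) = 4 E(A Psi) = 0; no continuity of E is required.  The same argument
  shows that E(Psi) = 0 unless the rows of Psi are independent, i.e. unless Psi has a right
  inverse R.

  By the convex roof property E of the output is the minimum of the sums of the E(V_i) over all
  decompositions of the output into unnormalised pure states V_i.  Kraus representations (K_j) yield
  the decompositions (K_j Psi).  Conversely every decomposition (V_i) is of this form, with Kraus
  operators V_i R.  So the minimum equals E(Psi) times the resilience factor.
*)

theory Submission
  imports Defs
begin

section \<open>Entrywise formulas for matrix products, adjoints and sums\<close>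

lemma index_mult_mat_sum:
  assumes "A \<in> carrier_mat n k" "B \<in> carrier_mat k p" "i < n" "j < p"
  shows "(A * B) $$ (i, j) = (\<Sum>c<k. A $$ (i, c) * B $$ (c, j))"
  using assms by (auto simp: scalar_prod_def atLeast0LessThan intro!: sum.cong)

lemma index_mult_mat_vec_sum:
  assumes "A \<in> carrier_mat n k" "v \<in> carrier_vec k" "i < n"
  shows "(A *\<^sub>v v) $ i = (\<Sum>c<k. A $$ (i, c) * v $ c)"
  using assms by (auto simp: scalar_prod_def atLeast0LessThan intro!: sum.cong)

lemma smult_mat_mult_vec:
  assumes "A \<in> carrier_mat n k" "v \<in> carrier_vec k"
  shows "(c \<cdot>\<^sub>m A) *\<^sub>v v = c \<cdot>\<^sub>v (A *\<^sub>v v)"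
  using assms by (intro eq_vecI) (auto simp: smult_scalar_prod_distrib[of _ k])

lemma mat_adjoint_carrier: "A \<in> carrier_mat n k \<Longrightarrow> mat_adjoint A \<in> carrier_mat k n"
  by (auto simp: mat_adjoint_def)

lemma index_mat_adjoint:
  fixes A :: "complex mat"
  assumes "A \<in> carrier_mat n k" "i < k" "j < n"
  shows "mat_adjoint A $$ (i, j) = cnj (A $$ (j, i))"
  using assms by (auto simp: mat_adjoint_def mat_of_rows_index)

lemma sum_list_sum_swap:
  fixes f :: "'a \<Rightarrow> 'b \<Rightarrow> 'c::comm_monoid_add"
  shows "(\<Sum>x\<leftarrow>xs. \<Sum>c\<in>C. f x c) = (\<Sum>c\<in>C. \<Sum>x\<leftarrow>xs. f x c)"
  by (induction xs) (auto simp: sum.distrib)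

lemma mat_sum_carrier: "set Ms \<subseteq> carrier_mat D D \<Longrightarrow> mat_sum D Ms \<in> carrier_mat D D"
  by (induction Ms) (auto simp: mat_sum_def)

lemma index_mat_sum:
  assumes "set Ms \<subseteq> carrier_mat D D" "i < D" "j < D"
  shows "mat_sum D Ms $$ (i, j) = (\<Sum>M\<leftarrow>Ms. M $$ (i, j))"
  using assms(1)
proof (induction Ms)
  case (Cons M Ms)
  then have "mat_sum D Ms \<in> carrier_mat D D" by (intro mat_sum_carrier) auto
  with Cons assms(2,3) show ?case by (auto simp: mat_sum_def)
qed (use assms in \<open>simp add: mat_sum_def\<close>)

section \<open>The product basis, and bipartite vectors as rectangular matrices\<close>

lemma sum_lessThan_mult:
  fixes f :: "nat \<Rightarrow> 'a::comm_monoid_add"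
  shows "(\<Sum>j<d * m. f j) = (\<Sum>k<d. \<Sum>a<m. f (k * m + a))"
proof -
  have "(\<Sum>j<d * m. f j) = (\<Sum>k<d. sum f {k * m..<k * m + m})"
    by (simp add: sum.nat_group)
  also have "\<dots> = (\<Sum>k<d. \<Sum>a<m. f (k * m + a))"
  proof (rule sum.cong[OF refl])
    fix k
    show "sum f {k * m..<k * m + m} = (\<Sum>a<m. f (k * m + a))"
      using sum.shift_bounds_nat_ivl[of f 0 "k * m" m] by (simp add: atLeast0LessThan add.commute)
  qed
  finally show ?thesis .
qed

lemma block_index_less:
  assumes "k < d" "a < m"
  shows "k * m + a < d * (m::nat)"
proof -
  have "k * m + a < Suc k * m" using assms by simp
  also have "\<dots> \<le> d * m" using assms by (intro mult_le_mono1) simp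
  finally show ?thesis .
qed

lemma block_index_div_mod:
  assumes "i < d * (m::nat)"
  shows "i div m < d" "i mod m < m"
proof -
  have "0 < m" using assms by (cases m) auto
  then show "i div m < d" "i mod m < m" using assms by (simp_all add: less_mult_imp_div_less)
qed

lemma block_index_div:
  assumes "a < (m::nat)"
  shows "(k * m + a) div m = k"
  using assms by auto

text \<open>Row-major order matches the lexicographic product basis: the entry \<open>(k, a)\<close>
  of a \<open>d\<close> by \<open>m\<close> matrix sits at position \<open>k * m + a\<close>, with
  the first factor most significant.\<close>

definition vectorize :: "complex mat \<Rightarrow> complex vec" where
  "vectorize V = vec (dim_row V * dim_col V) (\<lambda>i. V $$ (i div dim_col V, i mod dim_col V))"

definition unvectorize :: "nat \<Rightarrow> nat \<Rightarrow> complex vec \<Rightarrow> complex mat" where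
  "unvectorize d m v = mat d m (\<lambda>(k, a). v $ (k * m + a))"

lemma vectorize_carrier: "V \<in> carrier_mat d m \<Longrightarrow> vectorize V \<in> carrier_vec (d * m)"
  by (auto simp: vectorize_def)

lemma index_vectorize:
  "V \<in> carrier_mat d m \<Longrightarrow> i < d * m \<Longrightarrow> vectorize V $ i = V $$ (i div m, i mod m)"
  by (auto simp: vectorize_def)

lemma unvectorize_carrier: "unvectorize d m v \<in> carrier_mat d m"
  by (simp add: unvectorize_def)

lemma vectorize_unvectorize:
  assumes "v \<in> carrier_vec (d * m)"
  shows "vectorize (unvectorize d m v) = v"
  using assms by (intro eq_vecI) (auto simp: vectorize_def unvectorize_def block_index_div_mod)

lemma ketbra_carrier: "v \<in> carrier_vec D \<Longrightarrow> ketbra v \<in> carrier_mat D D"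
  by (auto simp: ketbra_def)

text \<open>Invariance of the measure is stated for conjugation of operators; this carries it over
  to the action on vectors.\<close>

lemma ketbra_mult_mat_vec:
  assumes B: "B \<in> carrier_mat D D" and v: "v \<in> carrier_vec D"
  shows "ketbra (B *\<^sub>v v) = B * ketbra v * mat_adjoint B"
proof (rule eq_matI)
  note B' = mat_adjoint_carrier[OF B] and k = ketbra_carrier[OF v]
  show "dim_row (ketbra (B *\<^sub>v v)) = dim_row (B * ketbra v * mat_adjoint B)"
    "dim_col (ketbra (B *\<^sub>v v)) = dim_col (B * ketbra v * mat_adjoint B)"
    using B B' by (auto simp: ketbra_def)
  fix i j assume "i < dim_row (B * ketbra v * mat_adjoint B)"
    "j < dim_col (B * ketbra v * mat_adjoint B)"
  then have ij: "i < D" "j < D" using B B' by auto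
  have "(B * ketbra v * mat_adjoint B) $$ (i, j)
      = (\<Sum>c<D. (\<Sum>e<D. B $$ (i, e) * (v $ e * cnj (v $ c))) * cnj (B $$ (j, c)))"
    unfolding index_mult_mat_sum[OF mult_carrier_mat[OF B k] B' ij]
  proof (rule sum.cong[OF refl])
    fix c assume "c \<in> {..<D}"
    then have c: "c < D" by simp
    show "(B * ketbra v) $$ (i, c) * mat_adjoint B $$ (c, j)
        = (\<Sum>e<D. B $$ (i, e) * (v $ e * cnj (v $ c))) * cnj (B $$ (j, c))"
      using v c unfolding index_mult_mat_sum[OF B k ij(1) c] index_mat_adjoint[OF B c ij(2)]
      by (simp add: ketbra_def)
  qed
  also have "\<dots> = (\<Sum>e<D. B $$ (i, e) * v $ e) * cnj (\<Sum>c<D. B $$ (j, c) * v $ c)"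
    by (simp add: sum_distrib_left sum_distrib_right mult_ac)
  also have "\<dots> = ketbra (B *\<^sub>v v) $$ (i, j)"
    using ij B v by (simp add: ketbra_def index_mult_mat_vec_sum[OF B v, symmetric] del: index_mult_mat_vec)
  finally show "ketbra (B *\<^sub>v v) $$ (i, j) = (B * ketbra v * mat_adjoint B) $$ (i, j)" by simp
qed

lemma kron_carrier:
  "A \<in> carrier_mat d d \<Longrightarrow> B \<in> carrier_mat m m \<Longrightarrow> kron A B \<in> carrier_mat (d * m) (d * m)"
  by (auto simp: kron_def)

lemma kron_one_mult_vectorize:
  assumes A: "A \<in> carrier_mat d d" and V: "V \<in> carrier_mat d m"
  shows "kron A (1\<^sub>m m) *\<^sub>v vectorize V = vectorize (A * V)"
proof (rule eq_vecI)
  note K = kron_carrier[OF A one_carrier_mat[of m]]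
  show "dim_vec (kron A (1\<^sub>m m) *\<^sub>v vectorize V) = dim_vec (vectorize (A * V))"
    using K A V by (auto simp: vectorize_def)
  fix i assume "i < dim_vec (vectorize (A * V))"
  then have i: "i < d * m" using A V by (auto simp: vectorize_def)
  note im = block_index_div_mod[OF i]
  have "(kron A (1\<^sub>m m) *\<^sub>v vectorize V) $ i
      = (\<Sum>j<d * m. kron A (1\<^sub>m m) $$ (i, j) * vectorize V $ j)"
    by (rule index_mult_mat_vec_sum[OF K vectorize_carrier[OF V] i])
  also have "\<dots> = (\<Sum>k<d. \<Sum>a<m. A $$ (i div m, k) * (if a = i mod m then V $$ (k, a) else 0))"
    unfolding sum_lessThan_mult
  proof (intro sum.cong refl)
    fix k a assume "k \<in> {..<d}" "a \<in> {..<m}"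
    then have ka: "k < d" "a < m" by auto
    note lt = block_index_less[OF ka]
    show "kron A (1\<^sub>m m) $$ (i, k * m + a) * vectorize V $ (k * m + a)
        = A $$ (i div m, k) * (if a = i mod m then V $$ (k, a) else 0)"
      using A i im ka lt by (auto simp: kron_def index_vectorize[OF V lt])
  qed
  also have "\<dots> = (\<Sum>k<d. A $$ (i div m, k) * V $$ (k, i mod m))"
    using im by (simp add: sum_distrib_left[symmetric])
  also have "\<dots> = vectorize (A * V) $ i"
    using index_mult_mat_sum[OF A V im] index_vectorize[OF mult_carrier_mat[OF A V] i] by simp
  finally show "(kron A (1\<^sub>m m) *\<^sub>v vectorize V) $ i = vectorize (A * V) $ i" .
qed

lemma ketbra_smult:
  "ketbra (c \<cdot>\<^sub>v v) = complex_of_real ((cmod c)\<^sup>2) \<cdot>\<^sub>m ketbra v"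
proof (rule eq_matI)
  show "dim_row (ketbra (c \<cdot>\<^sub>v v)) = dim_row (complex_of_real ((cmod c)\<^sup>2) \<cdot>\<^sub>m ketbra v)"
    "dim_col (ketbra (c \<cdot>\<^sub>v v)) = dim_col (complex_of_real ((cmod c)\<^sup>2) \<cdot>\<^sub>m ketbra v)"
    by (simp_all add: ketbra_def)
  fix i j
  assume "i < dim_row (complex_of_real ((cmod c)\<^sup>2) \<cdot>\<^sub>m ketbra v)"
    "j < dim_col (complex_of_real ((cmod c)\<^sup>2) \<cdot>\<^sub>m ketbra v)"
  then show "ketbra (c \<cdot>\<^sub>v v) $$ (i, j) = (complex_of_real ((cmod c)\<^sup>2) \<cdot>\<^sub>m ketbra v) $$ (i, j)"
    unfolding complex_norm_square by (simp add: ketbra_def mult_ac)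
qed

section \<open>Normalising an invertible matrix, and doubling a row-dependent one\<close>

text \<open>Polar form gives the root. Dividing a matrix of determinant \<open>z\<close> by
  \<open>c\<close> makes it unimodular, and \<open>(cmod c)\<^sup>2\<close> is the factor by which
  \<open>c\<close> rescales a ketbra.\<close>

lemma exists_root_complex:
  assumes "0 < d"
  shows "\<exists>c::complex. c ^ d = z \<and> (cmod c)\<^sup>2 = cmod z powr (2 / real d)"
proof (cases "z = 0")
  case True
  \<comment> \<open>Here \<open>0 powr x\<close> is 0 for every exponent, which agrees with the root
    0.\<close>
  then show ?thesis using assms by (intro exI[of _ 0]) auto
next
  case False
  define r where "r = cmod z powr (1 / real d)"
  define c where "c = complex_of_real r * cis (Arg z / real d)"
  have r: "0 \<le> r" by (simp add: r_def)
  have "r ^ d = cmod z"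
    using assms False by (simp add: r_def powr_realpow[symmetric] powr_powr)
  then have "c ^ d = complex_of_real (cmod z) * cis (Arg z)"
    using assms by (simp add: c_def power_mult_distrib DeMoivre of_real_power[symmetric] del: of_real_power)
  also have "\<dots> = z" using rcis_cmod_Arg[of z] by (simp add: rcis_def)
  finally have 1: "c ^ d = z" .
  have "(cmod c)\<^sup>2 = r\<^sup>2" using r by (simp add: c_def norm_mult)
  also have "\<dots> = cmod z powr (2 / real d)"
    using False by (simp add: r_def power2_eq_square powr_add[symmetric])
  finally show ?thesis using 1 by blast
qed

text \<open>
  In coordinates whose \<open>k\<close>-th one is \<open>w\<close>, the columns of \<open>A\<close> have vanishing \<open>k\<close>-th entry, so the
  diagonal matrix with \<open>2\<close> everywhere except at \<open>k\<close> doubles \<open>A\<close>, whatever its \<open>k\<close>-th entry is.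
\<close>

lemma unimodular_doubling:
  fixes w :: "complex vec"
  assumes A: "A \<in> carrier_mat n p" and w: "w \<in> carrier_vec n" "w \<noteq> 0\<^sub>v n"
    and wA: "\<And>j. j < p \<Longrightarrow> (\<Sum>i<n. w $ i * A $$ (i, j)) = 0"
  shows "\<exists>g \<in> carrier_mat n n. det g = 1 \<and> g * A = 2 \<cdot>\<^sub>m A"
proof -
  obtain k where k: "k < n" "w $ k \<noteq> 0"
    using w by (metis carrier_vecD eq_vecI index_zero_vec(1) index_zero_vec(2))
  \<comment> \<open>The change of coordinates: row \<open>k\<close> is \<open>w\<close>, every other
    row is that of the identity.\<close>
  define M where "M = mat n n (\<lambda>(i, j). if i = k then w $ j else if i = j then 1 else 0)"
  have M: "M \<in> carrier_mat n n" by (simp add: M_def)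
  have "det M \<noteq> 0"
  proof
    assume "det M = 0"
    then obtain x where x: "x \<in> carrier_vec n" "x \<noteq> 0\<^sub>v n" "M *\<^sub>v x = 0\<^sub>v n"
      using det_0_iff_vec_prod_zero[OF M] by auto
    have Mx: "(\<Sum>j<n. M $$ (i, j) * x $ j) = 0" if "i < n" for i
      using index_mult_mat_vec_sum[OF M x(1) that] x(3) that by simp
    \<comment> \<open>On a kernel vector the identity rows force all coordinates but the
      \<open>k\<close>-th to vanish; row \<open>k\<close> then leaves
      \<open>w $ k * x $ k = 0\<close>.\<close>
    have x0: "x $ i = 0" if "i < n" "i \<noteq> k" for i
      using Mx[OF that(1)] that by (simp add: M_def if_distrib[of "\<lambda>t. t * _"] cong: if_cong)
    have "(\<Sum>j<n. w $ j * x $ j) = 0" using Mx[OF k(1)] k(1) by (simp add: M_def)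
    moreover have "(\<Sum>j<n. w $ j * x $ j) = (\<Sum>j<n. if j = k then w $ k * x $ k else 0)"
      using x0 by (intro sum.cong) auto
    ultimately have "x $ k = 0" using k by simp
    have "x = 0\<^sub>v n"
    proof (rule eq_vecI)
      fix i assume "i < dim_vec (0\<^sub>v n :: complex vec)"
      then show "x $ i = 0\<^sub>v n $ i" using x0[of i] \<open>x $ k = 0\<close> by (cases "i = k") auto
    qed (use x(1) in simp)
    with x(2) show False by simp
  qed
  from det_non_zero_imp_unit[OF M this]
  obtain N where N: "N \<in> carrier_mat n n" "N * M = 1\<^sub>m n"
    unfolding Units_def by (auto simp: ring_mat_def)
  \<comment> \<open>Doubling all \<open>n\<close> rows multiplies the determinant by
    \<open>2 ^ n\<close>; scaling row \<open>k\<close> by \<open>s\<close> compensates for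
    this.\<close>
  define s where "s = 1 / (2::complex) ^ n"
  define T where "T = 2 \<cdot>\<^sub>m multrow_mat n k s"
  have T: "T \<in> carrier_mat n n" by (simp add: T_def)
  have detT: "det T = 1" using k(1) by (simp add: T_def det_multrow_mat s_def)
  have MA: "M * A \<in> carrier_mat n p" using M A by simp
  have row0: "(M * A) $$ (k, j) = 0" if "j < p" for j
    using index_mult_mat_sum[OF M A k(1) that] wA[OF that] k(1) by (simp add: M_def)
  have TMA: "T * (M * A) = 2 \<cdot>\<^sub>m (M * A)"
  proof -
    \<comment> \<open>Row \<open>k\<close> of \<open>M * A\<close> is zero, so scaling it changes
      nothing.\<close>
    have "multrow_mat n k s * (M * A) = M * A"
      unfolding multrow_mat[OF MA, symmetric]
      using row0 MA by (intro eq_matI) (auto simp: mat_multrow_gen_def simp del: index_mult_mat(1))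
    then show ?thesis
      using mult_smult_assoc_mat[of "multrow_mat n k s" n n "M * A" p 2] MA by (simp add: T_def)
  qed
  \<comment> \<open>The matrix sought is \<open>T\<close> conjugated back to the original
    coordinates, with \<open>N\<close> the inverse of \<open>M\<close>; conjugation preserves the
    determinant.\<close>
  have "det N * det M = 1" using det_mult[OF N(1) M] N(2) by simp
  then have "det (N * T * M) = 1"
    using det_mult[OF mult_carrier_mat[OF N(1) T] M] det_mult[OF N(1) T] detT by simp
  moreover have "N * T * M * A = 2 \<cdot>\<^sub>m A"
  proof -
    have "N * T * M * A = N * (T * (M * A))"
      using N(1) T M A by (simp add: assoc_mult_mat[of _ n n _ n _ n] assoc_mult_mat[of _ n n _ n _ p])
    also have "\<dots> = 2 \<cdot>\<^sub>m (N * M * A)"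
      using N(1) M A by (simp add: TMA mult_smult_distrib[OF N(1) MA] assoc_mult_mat[of _ n n _ n _ p])
    finally show ?thesis using N(2) A by simp
  qed
  ultimately show ?thesis using N(1) T M by (intro bexI[of _ "N * T * M"]) auto
qed


section \<open>Ensembles of unnormalised pure states\<close>

definition sq_norm :: "complex vec \<Rightarrow> real" where
  "sq_norm v = (\<Sum>i<dim_vec v. (cmod (v $ i))\<^sup>2)"

lemma sq_norm_nonneg: "0 \<le> sq_norm v"
  by (auto simp: sq_norm_def intro: sum_nonneg)

lemma scalar_prod_conjugate_self: "v \<bullet>c v = complex_of_real (sq_norm v)"
  by (simp add: scalar_prod_def sq_norm_def complex_norm_square atLeast0LessThan of_real_sum del: of_real_power)

lemma sq_norm_eq_0: "v \<in> carrier_vec D \<Longrightarrow> sq_norm v = 0 \<longleftrightarrow> v = 0\<^sub>v D"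
  using scalar_prod_conjugate_self[of v] conjugate_square_eq_0_vec[of v D] by simp

lemma sq_norm_smult: "sq_norm (c \<cdot>\<^sub>v v) = (cmod c)\<^sup>2 * sq_norm v"
  by (simp add: sq_norm_def norm_mult power_mult_distrib sum_distrib_left)

lemma pure_state_iff: "pure_state D v \<longleftrightarrow> v \<in> carrier_vec D \<and> sq_norm v = 1"
  unfolding pure_state_def scalar_prod_conjugate_self by auto

text \<open>Turns an unnormalised vector into the weighted form required by
  \<open>pure_decomposition\<close>. The zero vector has weight 0, so any unit vector serves for it;
  positivity of \<open>D\<close> guarantees that one exists.\<close>

lemma exists_pure_state_ketbra:
  assumes "0 < D" and v: "v \<in> carrier_vec D"
  shows "\<exists>u. pure_state D u \<and> ketbra v = complex_of_real (sq_norm v) \<cdot>\<^sub>m ketbra u"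
proof (cases "sq_norm v = 0")
  case True
  have "v \<bullet>c v = 1" if "v = unit_vec D 0" for v :: "complex vec"
    using \<open>0 < D\<close> that
    by (simp add: scalar_prod_def unit_vec_def if_distrib[of "\<lambda>t. t * _"] cong: if_cong)
  then have "pure_state D (unit_vec D 0)" by (simp add: pure_state_def)
  moreover have "ketbra v = complex_of_real (sq_norm v) \<cdot>\<^sub>m ketbra (unit_vec D 0)"
    using sq_norm_eq_0[OF v] True by (intro eq_matI) (auto simp: ketbra_def)
  ultimately show ?thesis by blast
next
  case False
  define c where "c = complex_of_real (sqrt (sq_norm v))"
  have c: "(cmod c)\<^sup>2 = sq_norm v" "c \<noteq> 0" using False sq_norm_nonneg[of v] by (simp_all add: c_def)
  define u where "u = (1 / c) \<cdot>\<^sub>v v"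
  have v_eq: "v = c \<cdot>\<^sub>v u" using c by (simp add: u_def smult_smult_assoc)
  have "pure_state D u"
    using v c False by (simp add: pure_state_iff u_def sq_norm_smult norm_divide power_divide)
  moreover have "ketbra v = complex_of_real (sq_norm v) \<cdot>\<^sub>m ketbra u"
    using ketbra_smult[of c u] c by (simp add: v_eq[symmetric])
  ultimately show ?thesis by blast
qed

lemma index_mat_sum_ketbra:
  assumes "set vs \<subseteq> carrier_vec D" "i < D" "j < D"
  shows "mat_sum D (map ketbra vs) $$ (i, j) = (\<Sum>v\<leftarrow>vs. v $ i * cnj (v $ j))"
proof -
  have "mat_sum D (map ketbra vs) $$ (i, j) = (\<Sum>M\<leftarrow>map ketbra vs. M $$ (i, j))"
    using assms by (intro index_mat_sum) (auto simp: ketbra_carrier)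
  also have "\<dots> = (\<Sum>v\<leftarrow>vs. v $ i * cnj (v $ j))"
    using assms unfolding map_map comp_def
    by (intro arg_cong[where f = sum_list] map_cong refl) (auto simp: ketbra_def)
  finally show ?thesis .
qed

lemma mat_sum_ketbra_carrier:
  "set vs \<subseteq> carrier_vec D \<Longrightarrow> mat_sum D (map ketbra vs) \<in> carrier_mat D D"
  by (rule mat_sum_carrier) (auto simp: ketbra_carrier)

lemma smult_mat_sum:
  "set Ms \<subseteq> carrier_mat D D \<Longrightarrow> c \<cdot>\<^sub>m mat_sum D Ms = mat_sum D (map (\<lambda>M. c \<cdot>\<^sub>m M) Ms)"
proof (induction Ms)
  case (Cons M Ms)
  then have "mat_sum D Ms \<in> carrier_mat D D" by (intro mat_sum_carrier) auto
  with Cons show ?case by (simp add: mat_sum_def add_smult_distrib_left_mat[of _ D D])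
qed (simp add: mat_sum_def)

lemma sum_list_diag_mat_sum_ketbra:
  assumes "set vs \<subseteq> carrier_vec D"
  shows "sum_list (diag_mat (mat_sum D (map ketbra vs))) = complex_of_real (\<Sum>v\<leftarrow>vs. sq_norm v)"
proof -
  note \<rho> = mat_sum_ketbra_carrier[OF assms]
  have "sum_list (diag_mat (mat_sum D (map ketbra vs)))
      = (\<Sum>i<D. mat_sum D (map ketbra vs) $$ (i, i))"
    using \<rho> by (simp add: diag_mat_def sum_list_distinct_conv_sum_set atLeast0LessThan)
  also have "\<dots> = (\<Sum>v\<leftarrow>vs. \<Sum>i<D. v $ i * cnj (v $ i))"
    using assms by (simp add: index_mat_sum_ketbra sum_list_sum_swap)
  also have "\<dots> = (\<Sum>v\<leftarrow>vs. complex_of_real (sq_norm v))"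
    using assms
    by (intro arg_cong[where f = sum_list] map_cong refl)
      (auto simp: sq_norm_def complex_norm_square of_real_sum simp del: of_real_power)
  also have "\<dots> = complex_of_real (\<Sum>v\<leftarrow>vs. sq_norm v)" by (induction vs) auto
  finally show ?thesis .
qed

lemma pos_semidef_mat_sum_ketbra:
  assumes vs: "set vs \<subseteq> carrier_vec D"
  shows "pos_semidef D (mat_sum D (map ketbra vs))"
proof -
  define \<rho> where "\<rho> = mat_sum D (map ketbra vs)"
  have \<rho>: "\<rho> \<in> carrier_mat D D" unfolding \<rho>_def by (rule mat_sum_ketbra_carrier[OF vs])
  have "0 \<le> (\<rho> *\<^sub>v x) \<bullet>c x" if x: "x \<in> carrier_vec D" for x
  proof -
    \<comment> \<open>\<open>z v\<close> is the inner product of \<open>v\<close> with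
      \<open>x\<close>; the quadratic form becomes the sum of the squared moduli of these.\<close>
    define z where "z v = (\<Sum>i<D. v $ i * cnj (x $ i))" for v
    have "(\<rho> *\<^sub>v x) \<bullet>c x = (\<Sum>i<D. (\<rho> *\<^sub>v x) $ i * cnj (x $ i))"
      using x \<rho> by (simp add: scalar_prod_def atLeast0LessThan del: index_mult_mat_vec)
    also have "\<dots> = (\<Sum>i<D. \<Sum>j<D. \<Sum>v\<leftarrow>vs. v $ i * cnj (v $ j) * x $ j * cnj (x $ i))"
    proof (rule sum.cong[OF refl])
      fix i assume "i \<in> {..<D}"
      then have i: "i < D" by simp
      show "(\<rho> *\<^sub>v x) $ i * cnj (x $ i)
          = (\<Sum>j<D. \<Sum>v\<leftarrow>vs. v $ i * cnj (v $ j) * x $ j * cnj (x $ i))"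
        unfolding index_mult_mat_vec_sum[OF \<rho> x i] sum_distrib_right
        using i by (intro sum.cong)
          (auto simp: \<rho>_def index_mat_sum_ketbra[OF vs] sum_list_mult_const[symmetric])
    qed
    also have "\<dots> = (\<Sum>v\<leftarrow>vs. \<Sum>i<D. \<Sum>j<D. v $ i * cnj (v $ j) * x $ j * cnj (x $ i))"
      by (simp add: sum_list_sum_swap)
    also have "\<dots> = (\<Sum>v\<leftarrow>vs. z v * cnj (z v))"
      by (simp add: z_def sum_product mult_ac)
    also have "0 \<le> \<dots>"
      by (intro sum_list_nonneg) (auto simp: complex_mult_cnj less_eq_complex_def)
    finally show ?thesis .
  qed
  then show ?thesis using \<rho> by (auto simp: pos_semidef_def \<rho>_def)
qed

lemma pos_semidef_smult:
  assumes "pos_semidef D A" "0 \<le> r"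
  shows "pos_semidef D (complex_of_real r \<cdot>\<^sub>m A)"
  unfolding pos_semidef_def
proof (intro conjI ballI)
  have A: "A \<in> carrier_mat D D" using assms by (simp add: pos_semidef_def)
  then show "complex_of_real r \<cdot>\<^sub>m A \<in> carrier_mat D D" by simp
  fix v :: "complex vec" assume v: "v \<in> carrier_vec D"
  have eq: "((complex_of_real r \<cdot>\<^sub>m A) *\<^sub>v v) \<bullet>c v = complex_of_real r * ((A *\<^sub>v v) \<bullet>c v)"
    using A v by (simp add: smult_mat_mult_vec smult_scalar_prod_distrib[of _ D])
  show "0 \<le> ((complex_of_real r \<cdot>\<^sub>m A) *\<^sub>v v) \<bullet>c v"
    unfolding eq using assms v by (auto simp: pos_semidef_def less_eq_complex_def)
qed

text \<open>The trace of a ketbra is the squared norm of its vector, so \<open>t\<close> is the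
  trace of the sum. Normalising is required because the convex roof is assumed for density operators
  only.\<close>

lemma density_operator_normalized:
  assumes vs: "set vs \<subseteq> carrier_vec D" and t: "t = (\<Sum>v\<leftarrow>vs. sq_norm v)" "0 < t"
  shows "density_operator D (complex_of_real (1 / t) \<cdot>\<^sub>m mat_sum D (map ketbra vs))"
proof -
  note \<rho> = mat_sum_ketbra_carrier[OF vs]
  have "sum_list (diag_mat (c \<cdot>\<^sub>m A)) = c * sum_list (diag_mat A)"
    if "A \<in> carrier_mat D D" for c and A :: "complex mat"
  proof -
    have "diag_mat (c \<cdot>\<^sub>m A) = map ((*) c) (diag_mat A)"
      using that by (auto simp: diag_mat_def)
    then show ?thesis by (simp add: sum_list_const_mult)
  qed
  from this[OF \<rho>] show ?thesis
    using pos_semidef_smult[OF pos_semidef_mat_sum_ketbra[OF vs], of "1 / t"] t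
    by (simp add: density_operator_def sum_list_diag_mat_sum_ketbra[OF vs])
qed


section \<open>Local unimodular operators on the first factor\<close>

lemma kron_one: "kron (1\<^sub>m a) (1\<^sub>m b) = 1\<^sub>m (a * b)"
proof (rule eq_matI)
  fix i j assume "i < dim_row (1\<^sub>m (a * b))" "j < dim_col (1\<^sub>m (a * b))"
  then have ij: "i < a * b" "j < a * b" by auto
  have "i div b = j div b \<and> i mod b = j mod b \<longleftrightarrow> i = j" by (metis div_mult_mod_eq)
  then show "kron (1\<^sub>m a) (1\<^sub>m b) $$ (i, j) = 1\<^sub>m (a * b) $$ (i, j)"
    using ij block_index_div_mod[OF ij(1)] block_index_div_mod[OF ij(2)] by (auto simp: kron_def)
qed (auto simp: kron_def)

lemma tensor_list_one: "tensor_list (map 1\<^sub>m ds) = 1\<^sub>m (prod_list ds)"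
  by (induction ds) (auto simp: tensor_list_def kron_one)

text \<open>Take identity matrices, of determinant 1, on all remaining factors; their tensor product
  collapses to one identity.\<close>

lemma kron_SL_tensor:
  assumes "g \<in> carrier_mat d d" "det g = 1"
  shows "kron g (1\<^sub>m (prod_list ds)) \<in> SL_tensor (d # ds)"
proof -
  have "kron g (1\<^sub>m (prod_list ds)) = tensor_list (g # map 1\<^sub>m ds)"
    using tensor_list_one[of ds] by (simp add: tensor_list_def)
  moreover have "(g # map 1\<^sub>m ds) ! i \<in> carrier_mat ((d # ds) ! i) ((d # ds) ! i)
      \<and> det ((g # map 1\<^sub>m ds) ! i) = 1" if "i < length (d # ds)" for i
    using assms that by (cases i) auto
  ultimately show ?thesis
    unfolding SL_tensor_def by (intro CollectI exI[of _ "g # map 1\<^sub>m ds"]) auto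
qed

lemma ketbra_vectorize_smult:
  "ketbra (vectorize (c \<cdot>\<^sub>m V)) = complex_of_real ((cmod c)\<^sup>2) \<cdot>\<^sub>m ketbra (vectorize V)"
proof -
  have "vectorize (c \<cdot>\<^sub>m V) = c \<cdot>\<^sub>v vectorize V"
  proof (rule eq_vecI)
    fix i assume "i < dim_vec (c \<cdot>\<^sub>v vectorize V)"
    then have "i < dim_row V * dim_col V" by (simp add: vectorize_def)
    with block_index_div_mod[OF this]
    show "vectorize (c \<cdot>\<^sub>m V) $ i = (c \<cdot>\<^sub>v vectorize V) $ i" by (simp add: vectorize_def)
  qed (simp add: vectorize_def)
  then show ?thesis by (simp add: ketbra_smult)
qed

section \<open>The measure on pure states across the cut between the first factor and the rest, and
  its convex roof\<close>

locale sl_measure =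
  fixes d :: nat and ds :: "nat list" and E :: "complex mat \<Rightarrow> real"
  assumes dims_pos: "0 < d" "\<forall>k \<in> set ds. 0 < k"
    and measure: "SL_invariant_measure (d # ds) E"
begin

abbreviation m :: nat where "m \<equiv> prod_list ds"

abbreviation "Ev V \<equiv> E (ketbra (vectorize V))"

lemma m_pos: "0 < m"
  using dims_pos(2) by (induction ds) auto

lemma E_nonneg: "\<rho> \<in> carrier_mat (d * m) (d * m) \<Longrightarrow> 0 \<le> E \<rho>"
  using measure by (auto simp: SL_invariant_measure_def Let_def)

lemma E_scale:
  "0 \<le> r \<Longrightarrow> \<rho> \<in> carrier_mat (d * m) (d * m) \<Longrightarrow> E (complex_of_real r \<cdot>\<^sub>m \<rho>) = r * E \<rho>"
  using measure by (auto simp: SL_invariant_measure_def Let_def)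

lemma E_roof:
  "density_operator (d * m) \<rho> \<Longrightarrow>
    is_minimum {\<Sum>(p, v) \<leftarrow> ps. p * E (ketbra v) | ps. pure_decomposition (d * m) \<rho> ps} (E \<rho>)"
  using measure by (simp add: SL_invariant_measure_def Let_def)

lemma Ev_carrier: "V \<in> carrier_mat d m \<Longrightarrow> ketbra (vectorize V) \<in> carrier_mat (d * m) (d * m)"
  by (intro ketbra_carrier vectorize_carrier)

lemma Ev_smult: "V \<in> carrier_mat d m \<Longrightarrow> Ev (c \<cdot>\<^sub>m V) = (cmod c)\<^sup>2 * Ev V"
  unfolding ketbra_vectorize_smult by (intro E_scale Ev_carrier) auto

lemma Ev_SL:
  assumes g: "g \<in> carrier_mat d d" "det g = 1" and V: "V \<in> carrier_mat d m"
  shows "Ev (g * V) = Ev V"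
proof -
  let ?g = "kron g (1\<^sub>m m)"
  have "ketbra (vectorize (g * V)) = ?g * ketbra (vectorize V) * mat_adjoint ?g"
    using ketbra_mult_mat_vec[OF kron_carrier[OF g(1) one_carrier_mat] vectorize_carrier[OF V]]
    by (simp add: kron_one_mult_vectorize[OF g(1) V])
  then show ?thesis
    using measure kron_SL_tensor[OF g, of ds] Ev_carrier[OF V]
    by (auto simp: SL_invariant_measure_def Let_def)
qed

text \<open>A unimodular \<open>g\<close> doubles \<open>V\<close>: invariance keeps the value and
  homogeneity multiplies it by 4. The lemma serves twice, for singular local operators and, in
  contrapositive form, to obtain independent rows of a state with nonzero measure.\<close>

lemma Ev_eq_0:
  assumes V: "V \<in> carrier_mat d m" and w: "w \<in> carrier_vec d" "w \<noteq> 0\<^sub>v d"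
    and wV: "\<And>j. j < m \<Longrightarrow> (\<Sum>i<d. w $ i * V $$ (i, j)) = 0"
  shows "Ev V = 0"
proof -
  obtain g where g: "g \<in> carrier_mat d d" "det g = 1" "g * V = 2 \<cdot>\<^sub>m V"
    using unimodular_doubling[OF V w wV] by auto
  have "Ev V = (cmod 2)\<^sup>2 * Ev V" using Ev_SL[OF g(1,2) V] Ev_smult[OF V, of 2] g(3) by simp
  then show ?thesis by simp
qed

lemma Ev_mult:
  assumes A: "A \<in> carrier_mat d d" and V: "V \<in> carrier_mat d m"
  shows "Ev (A * V) = cmod (det A) powr (2 / real d) * Ev V"
proof (cases "det A = 0")
  case True
  \<comment> \<open>Passing to the transpose yields a left kernel vector of \<open>A\<close>, which
    also annihilates \<open>A * V\<close> from the left. The claimed factor is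
    \<open>0 powr (2 / real d)\<close>, that is 0.\<close>
  then have "det (transpose_mat A) = 0" using det_transpose[OF A] by simp
  then obtain w where w: "w \<in> carrier_vec d" "w \<noteq> 0\<^sub>v d" "transpose_mat A *\<^sub>v w = 0\<^sub>v d"
    using det_0_iff_vec_prod_zero[of "transpose_mat A" d] A by auto
  have AT: "transpose_mat A \<in> carrier_mat d d" using A by simp
  have wA: "(\<Sum>i<d. w $ i * A $$ (i, k)) = 0" if "k < d" for k
    using index_mult_mat_vec_sum[OF AT w(1) that] w(3) that A by (simp add: mult.commute)
  have "(\<Sum>i<d. w $ i * (A * V) $$ (i, j)) = 0" if j: "j < m" for j
  proof -
    have "(\<Sum>i<d. w $ i * (A * V) $$ (i, j))
        = (\<Sum>i<d. \<Sum>k<d. w $ i * A $$ (i, k) * V $$ (k, j))"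
    proof (rule sum.cong[OF refl])
      fix i assume "i \<in> {..<d}"
      then have i: "i < d" by simp
      show "w $ i * (A * V) $$ (i, j) = (\<Sum>k<d. w $ i * A $$ (i, k) * V $$ (k, j))"
        unfolding index_mult_mat_sum[OF A V i j] by (simp add: sum_distrib_left mult.assoc)
    qed
    also have "\<dots> = (\<Sum>k<d. (\<Sum>i<d. w $ i * A $$ (i, k)) * V $$ (k, j))"
      by (subst sum.swap) (simp add: sum_distrib_right)
    finally show ?thesis using wA by simp
  qed
  from Ev_eq_0[OF mult_carrier_mat[OF A V] w(1,2) this] True show ?thesis by simp
next
  case False
  obtain c where c: "c ^ d = det A" "(cmod c)\<^sup>2 = cmod (det A) powr (2 / real d)"
    using exists_root_complex[OF dims_pos(1)] by blast
  have c0: "c \<noteq> 0" using False c(1) dims_pos(1) by (metis power_0_left less_numeral_extra(3))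
  \<comment> \<open>Its determinant is \<open>det A / c ^ d\<close>, hence 1.\<close>
  define g where "g = (1 / c) \<cdot>\<^sub>m A"
  have g: "g \<in> carrier_mat d d" using A by (simp add: g_def)
  have detg: "det g = 1" using A c False by (simp add: g_def power_divide)
  have "c \<cdot>\<^sub>m g = A" using c0 by (intro eq_matI) (auto simp: g_def)
  then have "A * V = c \<cdot>\<^sub>m (g * V)" using mult_smult_assoc_mat[OF g V, of c] by simp
  then show ?thesis
    using Ev_smult[OF mult_carrier_mat[OF g V], of c] Ev_SL[OF g detg V] c(2) by simp
qed

text \<open>The convex roof without normalisation. Both sides are homogeneous of degree 1 in the
  operator, so dividing by the trace reduces to density operators; probabilities are absorbed into
  the lengths of the vectors.\<close>

lemma E_mat_sum_ketbra:
  assumes vs: "set vs \<subseteq> carrier_vec (d * m)"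
  shows "E (mat_sum (d * m) (map ketbra vs)) \<le> (\<Sum>v\<leftarrow>vs. E (ketbra v))" (is ?upper)
    and "\<exists>us. set us \<subseteq> carrier_vec (d * m)
      \<and> mat_sum (d * m) (map ketbra us) = mat_sum (d * m) (map ketbra vs)
      \<and> E (mat_sum (d * m) (map ketbra vs)) = (\<Sum>u\<leftarrow>us. E (ketbra u))" (is ?attained)
proof -
  define D where "D = d * m"
  define \<rho> where "\<rho> = mat_sum D (map ketbra vs)"
  define t where "t = (\<Sum>v\<leftarrow>vs. sq_norm v)"
  have D_pos: "0 < D" using dims_pos(1) m_pos by (simp add: D_def)
  have vs: "set vs \<subseteq> carrier_vec D" using assms by (simp add: D_def)
  have \<rho>: "\<rho> \<in> carrier_mat D D" unfolding \<rho>_def by (rule mat_sum_ketbra_carrier[OF vs])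
  have sum_nonneg: "0 \<le> (\<Sum>v\<leftarrow>vs. E (ketbra v))"
    using vs E_nonneg ketbra_carrier by (intro sum_list_nonneg) (auto simp: D_def)
  have t_nonneg: "0 \<le> t" unfolding t_def by (intro sum_list_nonneg) (auto simp: sq_norm_nonneg)
  have "?upper \<and> ?attained" unfolding D_def[symmetric] \<rho>_def[symmetric]
  proof (cases "t = 0")
    \<comment> \<open>With trace 0 all vectors vanish and no normalisation is possible. The operator
      is zero, \<open>E\<close> vanishes there by scaling with 0, and the empty ensemble attains the
      value.\<close>
    case True
    then have "sq_norm v = 0" if "v \<in> set vs" for v
      using that unfolding t_def by (subst (asm) sum_list_nonneg_eq_0_iff) (auto simp: sq_norm_nonneg)
    then have zero: "v = 0\<^sub>v D" if "v \<in> set vs" for v using sq_norm_eq_0[of v D] vs that by auto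
    have "(\<Sum>v\<leftarrow>vs. v $ i * cnj (v $ j)) = (\<Sum>v\<leftarrow>vs. 0)" if "i < D" "j < D" for i j
      using that by (intro arg_cong[where f = sum_list] map_cong) (auto dest!: zero)
    then have \<rho>0: "\<rho> = 0\<^sub>m D D"
      using \<rho> index_mat_sum_ketbra[OF vs] by (intro eq_matI) (auto simp: \<rho>_def)
    have "E \<rho> = 0" using E_scale[of 0 \<rho>] \<rho> \<rho>0 by (simp add: D_def)
    then show "E \<rho> \<le> (\<Sum>v\<leftarrow>vs. E (ketbra v)) \<and> (\<exists>us. set us \<subseteq> carrier_vec D
        \<and> mat_sum D (map ketbra us) = \<rho> \<and> E \<rho> = (\<Sum>u\<leftarrow>us. E (ketbra u)))"
      using sum_nonneg \<rho>0 by (auto intro!: exI[of _ "[]"] simp: mat_sum_def)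
  next
    case False
    then have t: "0 < t" using t_nonneg by simp
    define \<sigma> where "\<sigma> = complex_of_real (1 / t) \<cdot>\<^sub>m \<rho>"
    have \<sigma>: "\<sigma> \<in> carrier_mat D D" using \<rho> by (simp add: \<sigma>_def)
    have "density_operator D \<sigma>"
      unfolding \<sigma>_def \<rho>_def by (rule density_operator_normalized[OF vs t_def t])
    from E_roof[folded D_def, OF this]
    have min: "is_minimum {\<Sum>(p, v) \<leftarrow> ps. p * E (ketbra v) | ps. pure_decomposition D \<sigma> ps} (E \<sigma>)" .
    have E\<sigma>: "E \<sigma> = E \<rho> / t" using E_scale[of "1 / t" \<rho>] t \<rho> by (simp add: \<sigma>_def D_def)
    obtain u where u: "pure_state D (u v) \<and> ketbra v = complex_of_real (sq_norm v) \<cdot>\<^sub>m ketbra (u v)"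
      if "v \<in> carrier_vec D" for v
      using exists_pure_state_ketbra[OF D_pos] by metis
    \<comment> \<open>Each vector contributes its direction, with its share of the trace as
      probability. This decomposition of the normalised operator gives the upper bound.\<close>
    define ps where "ps = map (\<lambda>v. (sq_norm v / t, u v)) vs"
    have ketbra_u: "complex_of_real (sq_norm v / t) \<cdot>\<^sub>m ketbra (u v) = complex_of_real (1 / t) \<cdot>\<^sub>m ketbra v"
      if "v \<in> set vs" for v
    proof -
      have "complex_of_real (1 / t) \<cdot>\<^sub>m ketbra v
          = complex_of_real (1 / t) \<cdot>\<^sub>m (complex_of_real (sq_norm v) \<cdot>\<^sub>m ketbra (u v))"
        using u[of v] vs that by auto
      also have "\<dots> = complex_of_real (sq_norm v / t) \<cdot>\<^sub>m ketbra (u v)"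
        by (intro eq_matI) auto
      finally show ?thesis by simp
    qed
    have "\<sigma> = mat_sum D (map (\<lambda>M. complex_of_real (1 / t) \<cdot>\<^sub>m M) (map ketbra vs))"
      unfolding \<sigma>_def \<rho>_def using vs by (intro smult_mat_sum) (auto simp: ketbra_carrier)
    also have "map (\<lambda>M. complex_of_real (1 / t) \<cdot>\<^sub>m M) (map ketbra vs)
        = map (\<lambda>(p, v). complex_of_real p \<cdot>\<^sub>m ketbra v) ps"
      using ketbra_u by (auto simp: ps_def)
    finally have "pure_decomposition D \<sigma> ps"
      using u vs t sq_norm_nonneg unfolding pure_decomposition_def by (auto simp: ps_def)
    then have "E \<sigma> \<le> (\<Sum>(p, v) \<leftarrow> ps. p * E (ketbra v))"
      using min unfolding is_minimum_def by blast
    also have "\<dots> = (\<Sum>v\<leftarrow>vs. E (ketbra v) / t)"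
    proof -
      have "sq_norm v / t * E (ketbra (u v)) = E (ketbra v) / t" if "v \<in> set vs" for v
        using E_scale[OF sq_norm_nonneg[of v], of "ketbra (u v)"] u[of v] vs that
          ketbra_carrier[of "u v" D]
        by (auto simp: D_def pure_state_def)
      then show ?thesis unfolding ps_def map_map comp_def
        by (intro arg_cong[where f = sum_list] map_cong) auto
    qed
    also have "\<dots> = (\<Sum>v\<leftarrow>vs. E (ketbra v)) / t" by (induction vs) (auto simp: add_divide_distrib)
    finally have upper: "E \<rho> \<le> (\<Sum>v\<leftarrow>vs. E (ketbra v))"
      using t by (simp add: E\<sigma> divide_le_cancel)
    obtain qs where qs: "pure_decomposition D \<sigma> qs" "E \<sigma> = (\<Sum>(p, v) \<leftarrow> qs. p * E (ketbra v))"
      using min unfolding is_minimum_def by blast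
    \<comment> \<open>The way back for an optimal decomposition: the factor
      \<open>sqrt (t * p)\<close> restores both the probability and the trace, since a ketbra is
      quadratic in its vector.\<close>
    define us where "us = map (\<lambda>(p, v). complex_of_real (sqrt (t * p)) \<cdot>\<^sub>v v) qs"
    have qs_pos: "0 \<le> p" "v \<in> carrier_vec D" if "(p, v) \<in> set qs" for p v
      using qs(1) that by (auto simp: pure_decomposition_def pure_state_def)
    have ket_us: "ketbra (complex_of_real (sqrt (t * p)) \<cdot>\<^sub>v v) = complex_of_real (t * p) \<cdot>\<^sub>m ketbra v"
      if "(p, v) \<in> set qs" for p v
      using qs_pos[OF that] t by (simp add: ketbra_smult)
    have us: "set us \<subseteq> carrier_vec D" using qs_pos(2) by (auto simp: us_def)
    have "\<rho> = complex_of_real t \<cdot>\<^sub>m \<sigma>" using t by (intro eq_matI) (auto simp: \<sigma>_def)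
    also have "\<dots> = mat_sum D (map (\<lambda>M. complex_of_real t \<cdot>\<^sub>m M)
        (map (\<lambda>(p, v). complex_of_real p \<cdot>\<^sub>m ketbra v) qs))"
      using qs(1) qs_pos(2)
      by (subst smult_mat_sum[symmetric]) (auto simp: pure_decomposition_def ketbra_carrier)
    also have "map (\<lambda>M. complex_of_real t \<cdot>\<^sub>m M) (map (\<lambda>(p, v). complex_of_real p \<cdot>\<^sub>m ketbra v) qs)
        = map ketbra us"
      by (auto simp: us_def ket_us intro!: eq_matI)
    finally have \<rho>_us: "mat_sum D (map ketbra us) = \<rho>" ..
    have "E (ketbra (complex_of_real (sqrt (t * p)) \<cdot>\<^sub>v v)) = t * (p * E (ketbra v))"
      if "(p, v) \<in> set qs" for p v
      unfolding ket_us[OF that] using E_scale[of "t * p" "ketbra v"] qs_pos[OF that] t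
      by (simp add: D_def ketbra_carrier)
    then have "(\<Sum>u\<leftarrow>us. E (ketbra u)) = (\<Sum>(p, v) \<leftarrow> qs. t * (p * E (ketbra v)))"
      unfolding us_def map_map comp_def
      by (intro arg_cong[where f = sum_list] map_cong) auto
    also have "\<dots> = t * (\<Sum>(p, v) \<leftarrow> qs. p * E (ketbra v))"
      by (induction qs) (auto simp: distrib_left)
    also have "\<dots> = E \<rho>" using t by (simp add: qs(2)[symmetric] E\<sigma>)
    finally show "E \<rho> \<le> (\<Sum>v\<leftarrow>vs. E (ketbra v)) \<and> (\<exists>us. set us \<subseteq> carrier_vec D
        \<and> mat_sum D (map ketbra us) = \<rho> \<and> E \<rho> = (\<Sum>u\<leftarrow>us. E (ketbra u)))"
      using upper us \<rho>_us by metis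
  qed
  then show ?upper ?attained by blast+
qed


end

section \<open>Comparing Kraus families with ensembles\<close>

text \<open>For a Kraus family these are the entries of the Choi matrix: the \<open>(k, l)\<close>
  entry of the image of the matrix unit \<open>|a><b|\<close>. For an ensemble of vectorised
  matrices they are the entries of its density operator, before normalisation. One array thus
  describes both.\<close>

definition corr :: "complex mat list \<Rightarrow> nat \<Rightarrow> nat \<Rightarrow> nat \<Rightarrow> nat \<Rightarrow> complex" where
  "corr Vs k a l b = (\<Sum>V\<leftarrow>Vs. V $$ (k, a) * cnj (V $$ (l, b)))"

text \<open>The family enters the right side only through its own coefficients, so families with
  equal coefficients stay indistinguishable after right multiplication. It is applied with
  \<open>T\<close> the state, its right inverse, and a projection.\<close>

lemma corr_mult_right:
  assumes Vs: "set Vs \<subseteq> carrier_mat d p" and T: "T \<in> carrier_mat p n"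
    and kl: "k < d" "l < d" and ab: "a < n" "b < n"
  shows "corr (map (\<lambda>V. V * T) Vs) k a l b
    = (\<Sum>c<p. \<Sum>e<p. T $$ (c, a) * cnj (T $$ (e, b)) * corr Vs k c l e)"
proof -
  have "(V * T) $$ (k, a) * cnj ((V * T) $$ (l, b)) = (\<Sum>c<p. \<Sum>e<p.
      T $$ (c, a) * cnj (T $$ (e, b)) * (V $$ (k, c) * cnj (V $$ (l, e))))" if "V \<in> set Vs" for V
  proof -
    have V: "V \<in> carrier_mat d p" using Vs that by auto
    show ?thesis
      unfolding index_mult_mat_sum[OF V T kl(1) ab(1)] index_mult_mat_sum[OF V T kl(2) ab(2)]
      by (simp add: sum_product mult_ac)
  qed
  then have "corr (map (\<lambda>V. V * T) Vs) k a l b = (\<Sum>V\<leftarrow>Vs. \<Sum>c<p. \<Sum>e<p.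
      T $$ (c, a) * cnj (T $$ (e, b)) * (V $$ (k, c) * cnj (V $$ (l, e))))"
    unfolding corr_def map_map comp_def by (intro arg_cong[where f = sum_list] map_cong) auto
  also have "\<dots> = (\<Sum>c<p. \<Sum>e<p. T $$ (c, a) * cnj (T $$ (e, b)) * corr Vs k c l e)"
    by (simp add: sum_list_sum_swap sum_list_const_mult corr_def)
  finally show ?thesis .
qed

lemma index_kraus_sum:
  assumes Ks: "set Ks \<subseteq> carrier_mat d d" and \<rho>: "\<rho> \<in> carrier_mat d d" and kl: "k < d" "l < d"
  shows "mat_sum d (map (\<lambda>K. K * \<rho> * mat_adjoint K) Ks) $$ (k, l)
    = (\<Sum>c<d. \<Sum>e<d. \<rho> $$ (c, e) * corr Ks k c l e)"
proof -
  have "mat_sum d (map (\<lambda>K. K * \<rho> * mat_adjoint K) Ks) $$ (k, l)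
      = (\<Sum>M\<leftarrow>map (\<lambda>K. K * \<rho> * mat_adjoint K) Ks. M $$ (k, l))"
    using Ks \<rho> kl by (intro index_mat_sum) (auto intro!: mult_carrier_mat mat_adjoint_carrier)
  also have "\<dots> = (\<Sum>K\<leftarrow>Ks. \<Sum>c<d. \<Sum>e<d. \<rho> $$ (c, e) * (K $$ (k, c) * cnj (K $$ (l, e))))"
    unfolding map_map comp_def
  proof (intro arg_cong[where f = sum_list] map_cong refl)
    fix K assume "K \<in> set Ks"
    then have K: "K \<in> carrier_mat d d" using Ks by auto
    have "(K * \<rho> * mat_adjoint K) $$ (k, l)
        = (\<Sum>e<d. (\<Sum>c<d. K $$ (k, c) * \<rho> $$ (c, e)) * cnj (K $$ (l, e)))"
      unfolding index_mult_mat_sum[OF mult_carrier_mat[OF K \<rho>] mat_adjoint_carrier[OF K] kl]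
      using index_mult_mat_sum[OF K \<rho> kl(1)] index_mat_adjoint[OF K _ kl(2)]
      by (intro sum.cong) auto
    also have "\<dots> = (\<Sum>c<d. \<Sum>e<d. \<rho> $$ (c, e) * (K $$ (k, c) * cnj (K $$ (l, e))))"
      unfolding sum_distrib_right by (subst sum.swap) (simp add: mult_ac)
    finally show "(K * \<rho> * mat_adjoint K) $$ (k, l)
        = (\<Sum>c<d. \<Sum>e<d. \<rho> $$ (c, e) * (K $$ (k, c) * cnj (K $$ (l, e))))" .
  qed
  also have "\<dots> = (\<Sum>c<d. \<Sum>e<d. \<rho> $$ (c, e) * corr Ks k c l e)"
    by (simp add: sum_list_sum_swap sum_list_const_mult corr_def)
  finally show ?thesis .
qed

lemma kraus_sum_carrier:
  assumes "set Ks \<subseteq> carrier_mat d d" "\<rho> \<in> carrier_mat d d"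
  shows "mat_sum d (map (\<lambda>K. K * \<rho> * mat_adjoint K) Ks) \<in> carrier_mat d d"
  using assms by (intro mat_sum_carrier) (auto intro!: mult_carrier_mat mat_adjoint_carrier)

text \<open>By \<open>index_kraus_sum\<close> the map depends on the Kraus operators only through
  their Choi entries.\<close>

lemma kraus_rep_corr_cong:
  assumes "kraus_rep d \<Phi> Ks" "set Ls \<subseteq> carrier_mat d d"
    and "\<And>k c l e. k < d \<Longrightarrow> c < d \<Longrightarrow> l < d \<Longrightarrow> e < d \<Longrightarrow> corr Ls k c l e = corr Ks k c l e"
  shows "kraus_rep d \<Phi> Ls"
  unfolding kraus_rep_def
proof (intro conjI ballI)
  fix \<rho> :: "complex mat" assume \<rho>: "\<rho> \<in> carrier_mat d d"
  have Ks: "set Ks \<subseteq> carrier_mat d d" using assms(1) by (simp add: kraus_rep_def)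
  have "mat_sum d (map (\<lambda>K. K * \<rho> * mat_adjoint K) Ks)
      = mat_sum d (map (\<lambda>K. K * \<rho> * mat_adjoint K) Ls)"
  proof (rule eq_matI)
    fix k l assume "k < dim_row (mat_sum d (map (\<lambda>K. K * \<rho> * mat_adjoint K) Ls))"
      "l < dim_col (mat_sum d (map (\<lambda>K. K * \<rho> * mat_adjoint K) Ls))"
    then have kl: "k < d" "l < d" using kraus_sum_carrier[OF assms(2) \<rho>] by auto
    show "mat_sum d (map (\<lambda>K. K * \<rho> * mat_adjoint K) Ks) $$ (k, l)
        = mat_sum d (map (\<lambda>K. K * \<rho> * mat_adjoint K) Ls) $$ (k, l)"
      unfolding index_kraus_sum[OF Ks \<rho> kl] index_kraus_sum[OF assms(2) \<rho> kl]
      using assms(3) kl by (intro sum.cong) auto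
  qed (use kraus_sum_carrier[OF assms(2) \<rho>] kraus_sum_carrier[OF Ks \<rho>] in auto)
  then show "\<Phi> \<rho> = mat_sum d (map (\<lambda>K. K * \<rho> * mat_adjoint K) Ls)"
    using assms(1) \<rho> by (simp add: kraus_rep_def)
qed (use assms in auto)

lemma index_mat_sum_ketbra_vectorize:
  assumes Vs: "set Vs \<subseteq> carrier_mat d m" and ij: "i < d * m" "j < d * m"
  shows "mat_sum (d * m) (map ketbra (map vectorize Vs)) $$ (i, j)
    = corr Vs (i div m) (i mod m) (j div m) (j mod m)"
proof -
  have "mat_sum (d * m) (map ketbra (map vectorize Vs)) $$ (i, j)
      = (\<Sum>v\<leftarrow>map vectorize Vs. v $ i * cnj (v $ j))"
    using Vs ij by (intro index_mat_sum_ketbra) (auto intro: vectorize_carrier)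
  also have "\<dots> = corr Vs (i div m) (i mod m) (j div m) (j mod m)"
    unfolding corr_def map_map comp_def using Vs ij
    by (intro arg_cong[where f = sum_list] map_cong refl) (auto simp: index_vectorize)
  finally show ?thesis .
qed

lemma act_on_first_ketbra:
  assumes \<Phi>: "kraus_rep d \<Phi> Ks" and \<Psi>: "\<Psi> \<in> carrier_mat d m"
  shows "act_on_first d m \<Phi> (ketbra (vectorize \<Psi>))
    = mat_sum (d * m) (map ketbra (map vectorize (map (\<lambda>K. K * \<Psi>) Ks)))"
proof (rule eq_matI)
  have Ks: "set Ks \<subseteq> carrier_mat d d" using \<Phi> by (simp add: kraus_rep_def)
  have K\<Psi>: "set (map (\<lambda>K. K * \<Psi>) Ks) \<subseteq> carrier_mat d m"
    using Ks \<Psi> by (auto intro!: mult_carrier_mat)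
  then have S: "mat_sum (d * m) (map ketbra (map vectorize (map (\<lambda>K. K * \<Psi>) Ks)))
      \<in> carrier_mat (d * m) (d * m)"
    by (intro mat_sum_ketbra_carrier) (auto intro: vectorize_carrier)
  then show "dim_row (act_on_first d m \<Phi> (ketbra (vectorize \<Psi>)))
      = dim_row (mat_sum (d * m) (map ketbra (map vectorize (map (\<lambda>K. K * \<Psi>) Ks))))"
    "dim_col (act_on_first d m \<Phi> (ketbra (vectorize \<Psi>)))
      = dim_col (mat_sum (d * m) (map ketbra (map vectorize (map (\<lambda>K. K * \<Psi>) Ks))))"
    by (simp_all add: act_on_first_def)
  fix i j assume "i < dim_row (mat_sum (d * m) (map ketbra (map vectorize (map (\<lambda>K. K * \<Psi>) Ks))))"
    "j < dim_col (mat_sum (d * m) (map ketbra (map vectorize (map (\<lambda>K. K * \<Psi>) Ks))))"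
  then have ij: "i < d * m" "j < d * m" using S by auto
  note im = block_index_div_mod[OF ij(1)] and jm = block_index_div_mod[OF ij(2)]
  \<comment> \<open>This block is the outer product of column \<open>i mod m\<close> of
    \<open>\<Psi>\<close> with the conjugate of column \<open>j mod m\<close>.\<close>
  let ?B = "first_block d m (ketbra (vectorize \<Psi>)) (i mod m) (j mod m)"
  have B: "?B \<in> carrier_mat d d" by (simp add: first_block_def)
  have "act_on_first d m \<Phi> (ketbra (vectorize \<Psi>)) $$ (i, j) = \<Phi> ?B $$ (i div m, j div m)"
    using ij by (simp add: act_on_first_def)
  also have "\<dots> = (\<Sum>c<d. \<Sum>e<d. ?B $$ (c, e) * corr Ks (i div m) c (j div m) e)"
    using \<Phi> B index_kraus_sum[OF Ks B im(1) jm(1)] by (simp add: kraus_rep_def)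
  also have "\<dots> = (\<Sum>c<d. \<Sum>e<d. \<Psi> $$ (c, i mod m) * cnj (\<Psi> $$ (e, j mod m))
      * corr Ks (i div m) c (j div m) e)"
  proof (intro sum.cong refl)
    fix c e assume "c \<in> {..<d}" "e \<in> {..<d}"
    then have "c < d" "e < d" by auto
    with block_index_less[OF _ im(2), of c d] block_index_less[OF _ jm(2), of e d] im(2) jm(2)
    show "?B $$ (c, e) * corr Ks (i div m) c (j div m) e
        = \<Psi> $$ (c, i mod m) * cnj (\<Psi> $$ (e, j mod m)) * corr Ks (i div m) c (j div m) e"
      using \<Psi> vectorize_carrier[OF \<Psi>]
      by (simp add: first_block_def ketbra_def index_vectorize[OF \<Psi>])
  qed
  also have "\<dots> = corr (map (\<lambda>K. K * \<Psi>) Ks) (i div m) (i mod m) (j div m) (j mod m)"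
    by (rule corr_mult_right[OF Ks \<Psi> im(1) jm(1) im(2) jm(2), symmetric])
  also have "\<dots> = mat_sum (d * m) (map ketbra (map vectorize (map (\<lambda>K. K * \<Psi>) Ks))) $$ (i, j)"
    by (rule index_mat_sum_ketbra_vectorize[OF K\<Psi> ij, symmetric])
  finally show "act_on_first d m \<Phi> (ketbra (vectorize \<Psi>)) $$ (i, j)
    = mat_sum (d * m) (map ketbra (map vectorize (map (\<lambda>K. K * \<Psi>) Ks))) $$ (i, j)" .
qed

text \<open>Independent rows make the Gram matrix \<open>G\<close> of the rows invertible, and the
  adjoint of \<open>\<Psi>\<close> times the inverse of \<open>G\<close> is a right inverse.\<close>

lemma exists_right_inverse:
  fixes \<Psi> :: "complex mat"
  assumes \<Psi>: "\<Psi> \<in> carrier_mat d m"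
    and rows: "\<And>w. w \<in> carrier_vec d \<Longrightarrow> (\<And>j. j < m \<Longrightarrow> (\<Sum>i<d. w $ i * \<Psi> $$ (i, j)) = 0)
      \<Longrightarrow> w = 0\<^sub>v d"
  shows "\<exists>R \<in> carrier_mat m d. \<Psi> * R = 1\<^sub>m d"
proof -
  note \<Psi>' = mat_adjoint_carrier[OF \<Psi>]
  define G where "G = \<Psi> * mat_adjoint \<Psi>"
  have G: "G \<in> carrier_mat d d" unfolding G_def using \<Psi> \<Psi>' by (rule mult_carrier_mat)
  have "det G \<noteq> 0"
  proof
    assume "det G = 0"
    then obtain x where x: "x \<in> carrier_vec d" "x \<noteq> 0\<^sub>v d" "G *\<^sub>v x = 0\<^sub>v d"
      using det_0_iff_vec_prod_zero[OF G] by auto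
    \<comment> \<open>\<open>y\<close> is the row vector obtained by multiplying
      \<open>\<Psi>\<close> on the left by the adjoint of \<open>x\<close>, so its squared norm is
      the quadratic form of \<open>G\<close> at \<open>x\<close>, which is 0.\<close>
    define y where "y a = (\<Sum>i<d. cnj (x $ i) * \<Psi> $$ (i, a))" for a
    have "(\<Sum>a<m. y a * cnj (y a))
        = (\<Sum>a<m. \<Sum>i<d. \<Sum>j<d. cnj (x $ i) * (\<Psi> $$ (i, a) * cnj (\<Psi> $$ (j, a)) * x $ j))"
      unfolding y_def cnj_sum sum_product by (simp add: mult_ac)
    also have "\<dots> = (\<Sum>i<d. \<Sum>j<d. \<Sum>a<m. cnj (x $ i) * (\<Psi> $$ (i, a) * cnj (\<Psi> $$ (j, a)) * x $ j))"
      by (subst sum.swap, rule sum.cong[OF refl], rule sum.swap)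
    also have "\<dots> = (\<Sum>i<d. cnj (x $ i) * (G *\<^sub>v x) $ i)"
    proof (rule sum.cong[OF refl])
      fix i assume "i \<in> {..<d}"
      then have i: "i < d" by simp
      have "G $$ (i, j) = (\<Sum>a<m. \<Psi> $$ (i, a) * cnj (\<Psi> $$ (j, a)))" if "j < d" for j
        unfolding G_def index_mult_mat_sum[OF \<Psi> \<Psi>' i that]
        using that by (intro sum.cong) (auto simp: index_mat_adjoint[OF \<Psi>])
      then show "(\<Sum>j<d. \<Sum>a<m. cnj (x $ i) * (\<Psi> $$ (i, a) * cnj (\<Psi> $$ (j, a)) * x $ j))
          = cnj (x $ i) * (G *\<^sub>v x) $ i"
        unfolding index_mult_mat_vec_sum[OF G x(1) i]
        by (simp add: sum_distrib_left sum_distrib_right)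
    qed
    also have "\<dots> = 0" using x(3) by simp
    finally have "complex_of_real (\<Sum>a<m. (cmod (y a))\<^sup>2) = 0"
      by (simp add: complex_norm_square of_real_sum del: of_real_power)
    then have "(\<Sum>a<m. (cmod (y a))\<^sup>2) = 0" by (simp only: of_real_eq_0_iff)
    then have "y a = 0" if "a < m" for a
      using that by (subst (asm) sum_nonneg_eq_0_iff) auto
    \<comment> \<open>The hypothesis on rows is bilinear, so it is applied to the conjugate of
      \<open>x\<close>.\<close>
    then have "vec d (\<lambda>i. cnj (x $ i)) = 0\<^sub>v d"
      by (intro rows) (auto simp: y_def)
    then have "cnj (x $ i) = 0" if "i < d" for i
      using that by (metis index_vec index_zero_vec(1))
    then have "x = 0\<^sub>v d" using x(1) by (intro eq_vecI) auto
    with x(2) show False by simp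
  qed
  from det_non_zero_imp_unit[OF G this]
  obtain N where N: "N \<in> carrier_mat d d" "G * N = 1\<^sub>m d"
    unfolding Units_def by (auto simp: ring_mat_def)
  have "\<Psi> * (mat_adjoint \<Psi> * N) = 1\<^sub>m d"
    using assoc_mult_mat[OF \<Psi> \<Psi>' N(1)] N(2) by (simp add: G_def)
  then show ?thesis using mult_carrier_mat[OF \<Psi>' N(1)] by blast
qed

text \<open>A diagonal coefficient is a sum of squared moduli, so its vanishing kills every
  term.\<close>

lemma eq_0_if_corr_eq_0:
  assumes "corr Vs k a k a = 0" "V \<in> set Vs"
  shows "V $$ (k, a) = 0"
proof -
  have "corr Vs k a k a = (\<Sum>V\<leftarrow>Vs. complex_of_real ((cmod (V $$ (k, a)))\<^sup>2))"
    unfolding corr_def complex_norm_square ..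
  also have "\<dots> = complex_of_real (\<Sum>V\<leftarrow>Vs. (cmod (V $$ (k, a)))\<^sup>2)" by (induction Vs) auto
  finally have "(\<Sum>V\<leftarrow>Vs. (cmod (V $$ (k, a)))\<^sup>2) = 0"
    using assms(1) by (metis of_real_eq_0_iff)
  then show ?thesis using assms(2) by (subst (asm) sum_list_nonneg_eq_0_iff) auto
qed

text \<open>
  If \<open>\<Psi>\<close> has a right inverse \<open>R\<close>, the unitary freedom of ensembles is trivial: the operators
  \<open>V R\<close> form a Kraus representation, and \<open>V = V R \<Psi>\<close> because \<open>\<Sum> |V (1 - R \<Psi>)|\<^sup>2\<close> equals
  \<open>\<Sum> |K \<Psi> (1 - R \<Psi>)|\<^sup>2 = 0\<close> entrywise.
\<close>

lemma kraus_rep_of_decomposition: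
  assumes \<Phi>: "kraus_rep d \<Phi> Ks" and \<Psi>: "\<Psi> \<in> carrier_mat d m"
    and R: "R \<in> carrier_mat m d" "\<Psi> * R = 1\<^sub>m d"
    and Vs: "set Vs \<subseteq> carrier_mat d m"
    and corr_eq: "\<And>k a l b. k < d \<Longrightarrow> a < m \<Longrightarrow> l < d \<Longrightarrow> b < m \<Longrightarrow>
      corr Vs k a l b = corr (map (\<lambda>K. K * \<Psi>) Ks) k a l b"
  shows "kraus_rep d \<Phi> (map (\<lambda>V. V * R) Vs)" and "V \<in> set Vs \<Longrightarrow> V * R * \<Psi> = V"
proof -
  have Ks: "set Ks \<subseteq> carrier_mat d d" using \<Phi> by (simp add: kraus_rep_def)
  have K\<Psi>: "set (map (\<lambda>K. K * \<Psi>) Ks) \<subseteq> carrier_mat d m"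
    using Ks \<Psi> by (auto intro!: mult_carrier_mat)
  have corr_mult: "corr (map (\<lambda>V. V * T) Vs) k a l b = corr (map (\<lambda>K. K * (\<Psi> * T)) Ks) k a l b"
    if T: "T \<in> carrier_mat m n" and kl: "k < d" "l < d" and ab: "a < n" "b < n" for T n k a l b
  proof -
    have eq: "map (\<lambda>K. K * (\<Psi> * T)) Ks = map (\<lambda>V. V * T) (map (\<lambda>K. K * \<Psi>) Ks)"
      using Ks assoc_mult_mat[OF _ \<Psi> T] by auto
    show ?thesis
      unfolding eq corr_mult_right[OF Vs T kl ab] corr_mult_right[OF K\<Psi> T kl ab]
      using kl by (intro sum.cong refl) (simp add: corr_eq)
  qed
  \<comment> \<open>With \<open>T = R\<close> the state cancels, and the coefficients are those of
    the original Kraus operators.\<close>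
  have "map (\<lambda>K. K * (\<Psi> * R)) Ks = Ks" using Ks R(2) by (auto intro!: map_idI)
  then show "kraus_rep d \<Phi> (map (\<lambda>V. V * R) Vs)"
    using corr_mult[OF R(1)] Vs R(1)
    by (intro kraus_rep_corr_cong[OF \<Phi>]) (auto intro!: mult_carrier_mat)
  define Q where "Q = 1\<^sub>m m - R * \<Psi>"
  have R\<Psi>: "R * \<Psi> \<in> carrier_mat m m" using R \<Psi> by (intro mult_carrier_mat)
  have Q: "Q \<in> carrier_mat m m" using minus_carrier_mat[OF R\<Psi>] by (simp add: Q_def)
  have "\<Psi> * Q = \<Psi> - \<Psi> * R * \<Psi>"
    unfolding Q_def using mult_minus_distrib_mat[OF \<Psi> one_carrier_mat R\<Psi>] \<Psi>
      assoc_mult_mat[OF \<Psi> R(1) \<Psi>] by simp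
  then have \<Psi>Q: "\<Psi> * Q = 0\<^sub>m d m" using R(2) \<Psi> by simp
  show "V * R * \<Psi> = V" if V: "V \<in> set Vs"
  proof -
    have Vc: "V \<in> carrier_mat d m" using Vs V by auto
    have VQ: "(V * Q) $$ (k, a) = 0" if ka: "k < d" "a < m" for k a
    proof (rule eq_0_if_corr_eq_0)
      have "corr (map (\<lambda>V. V * Q) Vs) k a k a = corr (map (\<lambda>K. K * 0\<^sub>m d m) Ks) k a k a"
        using corr_mult[OF Q ka(1) ka(1) ka(2) ka(2)] \<Psi>Q by simp
      also have "map (\<lambda>K. K * 0\<^sub>m d m) Ks = map (\<lambda>K. 0\<^sub>m d m) Ks" using Ks by auto
      also have "corr (map (\<lambda>K. 0\<^sub>m d m) Ks) k a k a = 0"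
        unfolding corr_def using ka by (induction Ks) auto
      finally show "corr (map (\<lambda>V. V * Q) Vs) k a k a = 0" .
    qed (use V in auto)
    have VR\<Psi>: "V * R * \<Psi> \<in> carrier_mat d m" using Vc R(1) \<Psi> by (intro mult_carrier_mat)
    have "V * Q = V - V * R * \<Psi>"
      unfolding Q_def using mult_minus_distrib_mat[OF Vc one_carrier_mat R\<Psi>] Vc
        assoc_mult_mat[OF Vc R(1) \<Psi>] by simp
    then have "V $$ (k, a) - (V * R * \<Psi>) $$ (k, a) = 0" if "k < d" "a < m" for k a
      using VQ[OF that] that Vc VR\<Psi> by (metis carrier_matD index_minus_mat(1))
    then show ?thesis using Vc VR\<Psi> by (intro eq_matI) (auto simp del: index_mult_mat(1))
  qed
qed

section \<open>The minimum over Kraus representations\<close>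

context sl_measure
begin

text \<open>The minimised set does not mention \<open>\<Psi>\<close>, whereas the ratio does; this
  is what makes the ratio independent of the state. Attainment comes from the optimal ensemble
  granted by the convex roof.\<close>

lemma is_minimum_resilience_values:
  assumes \<Phi>: "kraus_rep d \<Phi> Ks" and \<Psi>: "\<Psi> \<in> carrier_mat d m" and nz: "Ev \<Psi> \<noteq> 0"
  shows "is_minimum (resilience_values d \<Phi>)
    (E (act_on_first d m \<Phi> (ketbra (vectorize \<Psi>))) / Ev \<Psi>)"
proof -
  define \<rho> where "\<rho> = act_on_first d m \<Phi> (ketbra (vectorize \<Psi>))"
  have pos: "0 < Ev \<Psi>" using E_nonneg[OF Ev_carrier[OF \<Psi>]] nz by simp
  have vectors: "set (map vectorize (map (\<lambda>L. L * \<Psi>) Ls)) \<subseteq> carrier_vec (d * m)"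
    if "kraus_rep d \<Phi> Ls" for Ls
    using that \<Psi> by (auto simp: kraus_rep_def intro!: vectorize_carrier mult_carrier_mat)
  have sum_Ev: "(\<Sum>L\<leftarrow>Ls. Ev (L * \<Psi>)) = (\<Sum>L\<leftarrow>Ls. cmod (det L) powr (2 / real d)) * Ev \<Psi>"
    if "kraus_rep d \<Phi> Ls" for Ls
  proof -
    have "(\<Sum>L\<leftarrow>Ls. Ev (L * \<Psi>)) = (\<Sum>L\<leftarrow>Ls. cmod (det L) powr (2 / real d) * Ev \<Psi>)"
      using that Ev_mult[OF _ \<Psi>]
      by (intro arg_cong[where f = sum_list] map_cong) (auto simp: kraus_rep_def)
    then show ?thesis by (simp add: sum_list_mult_const)
  qed
  have lower: "E \<rho> / Ev \<Psi> \<le> x" if "x \<in> resilience_values d \<Phi>" for x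
  proof -
    obtain Ls where Ls: "kraus_rep d \<Phi> Ls" "x = (\<Sum>L\<leftarrow>Ls. cmod (det L) powr (2 / real d))"
      using \<open>x \<in> resilience_values d \<Phi>\<close> by (auto simp: resilience_values_def)
    have "E \<rho> \<le> (\<Sum>v\<leftarrow>map vectorize (map (\<lambda>L. L * \<Psi>) Ls). E (ketbra v))"
      using E_mat_sum_ketbra(1)[OF vectors[OF Ls(1)]] act_on_first_ketbra[OF Ls(1) \<Psi>]
      by (simp add: \<rho>_def)
    also have "\<dots> = x * Ev \<Psi>" using sum_Ev[OF Ls(1)] Ls(2) by (simp add: comp_def)
    finally show ?thesis using pos by (simp add: pos_divide_le_eq)
  qed
  \<comment> \<open>Contrapositive of \<open>Ev_eq_0\<close>: a nonzero row relation would make the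
    measure of \<open>\<Psi>\<close> vanish.\<close>
  have "w = 0\<^sub>v d" if "w \<in> carrier_vec d"
    "\<And>j. j < m \<Longrightarrow> (\<Sum>i<d. w $ i * \<Psi> $$ (i, j)) = 0" for w
    using Ev_eq_0[OF \<Psi> that(1) _ that(2)] nz by blast
  then obtain R where R: "R \<in> carrier_mat m d" "\<Psi> * R = 1\<^sub>m d"
    using exists_right_inverse[OF \<Psi>] by blast
  define Ws where "Ws = map (\<lambda>K. K * \<Psi>) Ks"
  have Ws: "set Ws \<subseteq> carrier_mat d m"
    using \<Phi> \<Psi> by (auto simp: Ws_def kraus_rep_def intro!: mult_carrier_mat)
  have \<rho>: "\<rho> = mat_sum (d * m) (map ketbra (map vectorize Ws))"
    unfolding \<rho>_def Ws_def by (rule act_on_first_ketbra[OF \<Phi> \<Psi>])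
  obtain us where us: "set us \<subseteq> carrier_vec (d * m)" "mat_sum (d * m) (map ketbra us) = \<rho>"
    "E \<rho> = (\<Sum>u\<leftarrow>us. E (ketbra u))"
    using E_mat_sum_ketbra(2)[OF vectors[OF \<Phi>]] unfolding \<rho> Ws_def by blast
  define Vs where "Vs = map (unvectorize d m) us"
  have Vs: "set Vs \<subseteq> carrier_mat d m" by (auto simp: Vs_def unvectorize_carrier)
  have us_eq: "us = map vectorize Vs"
    using us(1) by (auto simp: Vs_def vectorize_unvectorize intro!: map_idI[symmetric])
  \<comment> \<open>Both ensembles sum to the same operator; its entry at
    \<open>(k * m + a, l * m + b)\<close> is the coefficient in question.\<close>
  have corr_eq: "corr Vs k a l b = corr Ws k a l b"
    if "k < d" "a < m" "l < d" "b < m" for k a l b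
  proof -
    note lt = block_index_less[OF that(1,2)] block_index_less[OF that(3,4)]
    show ?thesis
      using index_mat_sum_ketbra_vectorize[OF Vs lt] index_mat_sum_ketbra_vectorize[OF Ws lt]
        us(2) \<rho> us_eq by (simp add: block_index_div that)
  qed
  note kraus = kraus_rep_of_decomposition[OF \<Phi> \<Psi> R Vs corr_eq[unfolded Ws_def]]
  have "E \<rho> = (\<Sum>V\<leftarrow>Vs. Ev V)" using us(3) us_eq by (simp add: comp_def)
  \<comment> \<open>Each optimal \<open>V\<close> is recovered as \<open>V * R * \<Psi>\<close>, so
    the optimal ensemble is itself produced by Kraus operators.\<close>
  also have "\<dots> = (\<Sum>L\<leftarrow>map (\<lambda>V. V * R) Vs. Ev (L * \<Psi>))"
    unfolding map_map comp_def using kraus(2) by (intro arg_cong[where f = sum_list] map_cong) auto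
  also have "\<dots> = (\<Sum>L\<leftarrow>map (\<lambda>V. V * R) Vs. cmod (det L) powr (2 / real d)) * Ev \<Psi>"
    by (rule sum_Ev[OF kraus(1)])
  finally have "E \<rho> / Ev \<Psi> = (\<Sum>L\<leftarrow>map (\<lambda>V. V * R) Vs. cmod (det L) powr (2 / real d))"
    using pos by simp
  then have "E \<rho> / Ev \<Psi> \<in> resilience_values d \<Phi>"
    using kraus(1) unfolding resilience_values_def by blast
  then show ?thesis using lower unfolding is_minimum_def \<rho>_def by blast
qed

end

text \<open>Minima of real sets are unique by antisymmetry, so exhibiting one settles the definite
  description.\<close>

lemma resilience_factor_eq:
  assumes "is_minimum (resilience_values d \<Phi>) x"
  shows "resilience_factor d \<Phi> = x"
  unfolding resilience_factor_def
  using assms by (intro the_equality) (auto simp: is_minimum_def intro: antisym)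

theorem theorem2:
  fixes ds :: "nat list" and E :: "complex mat \<Rightarrow> real"
    and \<psi> \<phi> :: "complex vec" and Chan :: "complex mat \<Rightarrow> complex mat"
  defines "D \<equiv> prod_list ds" and "d \<equiv> hd ds"
  defines "\<Lambda> \<equiv> act_on_first d (prod_list (tl ds)) Chan"
  assumes "ds \<noteq> []" and "\<forall>k \<in> set ds. 0 < k"
    and "SL_invariant_measure ds E"
    and "pure_state D \<psi>" and "pure_state D \<phi>"
    and "E (ketbra \<psi>) \<noteq> 0" and "E (ketbra \<phi>) \<noteq> 0"
    and "quantum_channel d Chan"
  shows "is_minimum (resilience_values d Chan) (resilience_factor d Chan)
    \<and> E (\<Lambda> (ketbra \<psi>)) / E (ketbra \<psi>) = E (\<Lambda> (ketbra \<phi>)) / E (ketbra \<phi>)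
    \<and> E (\<Lambda> (ketbra \<phi>)) / E (ketbra \<phi>) = resilience_factor d Chan"
proof -
  have ds: "ds = d # tl ds" using \<open>ds \<noteq> []\<close> by (simp add: d_def)
  then have D: "D = d * prod_list (tl ds)" unfolding D_def by (metis prod_list.Cons)
  interpret sl_measure d "tl ds" E
    using assms(5,6) ds by unfold_locales (metis list.set_intros)+
  obtain Ks where Ks: "kraus_rep d Chan Ks"
    using \<open>quantum_channel d Chan\<close> by (auto simp: quantum_channel_def)
  \<comment> \<open>Stated for an arbitrary state of nonzero measure, so that the ratios of both
    given states become minima of one set and coincide.\<close>
  have min: "is_minimum (resilience_values d Chan) (E (\<Lambda> (ketbra v)) / E (ketbra v))"
    if "pure_state D v" "E (ketbra v) \<noteq> 0" for v
  proof -
    have v: "vectorize (unvectorize d (prod_list (tl ds)) v) = v"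
      using that(1) by (intro vectorize_unvectorize) (simp add: pure_state_def D)
    show ?thesis
      using is_minimum_resilience_values[OF Ks unvectorize_carrier, of v] that(2)
      unfolding v \<Lambda>_def by simp
  qed
  from min[OF \<open>pure_state D \<psi>\<close> \<open>E (ketbra \<psi>) \<noteq> 0\<close>] min[OF \<open>pure_state D \<phi>\<close> \<open>E (ketbra \<phi>) \<noteq> 0\<close>]
  show ?thesis using resilience_factor_eq by metis
qed

end
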